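(* Let $\mathcal{CB}(\mathcal{C},\mathcal{W}_t,\mathcal{W}_r)$ be a cellular blind interference alignment problem under the spatially i.i.d. fading assumption, and let $\mathcal{GIC}(\mathcal{W}_r,\overline{\mathcal{W}}_r)$ be the Gaussian index coding problem with the same desired message sets $\mathcal{W}_r$ and with $\overline{\mathcal{W}}_r=\bigcup_{t\in\mathcal{T}:\,c_{rt}=0}\mathcal{W}_t$ for every $r\in\mathcal{R}$. Then $\mathrm{DoF}(\mathcal{CB}(\mathcal{C},\mathcal{W}_t,\mathcal{W}_r))\le \mathrm{DoF}(\mathcal{GIC}(\mathcal{W}_r,\overline{\mathcal{W}}_r))$.
   Context: A cellular blind interference alignment (CB) problem $\mathcal{CB}(\mathcal{C},\mathcal{W}_t,\mathcal{W}_r)$: transmitter set $\mathcal{T}$, receiver set $\mathcal{R}$, set $\mathcal{W}$ of independent messages; each transmitter $t$ has a message set $\mathcal{W}_t\subset\mathcal{W}$, the $\mathcal{W}_t$ being pairwise disjoint with union $\mathcal{W}$; each receiver $r$ desires $\mathcal{W}_r\subset\mathcal{W}$; $\mathcal{C}=\{(r,t): c_{rt}=1\}$ with fixed connectivity indicators $c_{rt}\in\{0,1\}$. All nodes have a single antenna; at channel use $n$, receiver $r$ observes $Y_r(n)=\sum_{t}c_{rt}H_{rt}(n)X_t(n)+Z_r(n)$ with i.i.d. zero-mean unit-variance circularly symmetric complex Gaussian noise, $E|X_t|^2\le P$, and channel magnitudes in a fixed interval bounded away from $0$ and $\infty$. Receiver $r$ knows $H_{rt}(n)$ for all $t$ with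 $c_{rt}=1$; transmitters know the connectivity and channel statistics but not channel realizations (no CSIT). Channels follow a block fading model (constant over blocks of a common length, i.i.d. across blocks from a continuous distribution). Spatially i.i.d. fading: channel processes are independent and identically distributed across all pairs $(r,t)$. A Gaussian index coding problem $\mathcal{GIC}(\mathcal{W}_r,\overline{\mathcal{W}}_r)$: a single single-antenna transmitter knowing all messages in $\mathcal{W}$ sends $X(n)$ with $E|X|^2\le P$; receiver $r$ observes $Y_r(n)=X(n)+Z_r(n)$ with unit-variance circularly symmetric complex Gaussian noise, knows the messages $\overline{\mathcal{W}}_r$ a priori, and desires $\mathcal{W}_r$. DoF of a problem means the sum DoF, $\lim_{P\to\infty}$ of the sum capacity divided by $\log P$. *)

theory Defs
  imports "HOL-Probability.Probability"
begin

definition cgauss :: "complex measure" where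
  "cgauss = density lborel (\<lambda>z. ennreal (exp (- (cmod z)\<^sup>2) / pi))"

definition noiseM :: "'r set \<Rightarrow> nat \<Rightarrow> (('r \<times> nat) \<Rightarrow> complex) measure" where
  "noiseM Rx n = PiM (Rx \<times> {..<n}) (\<lambda>_. cgauss)"

text \<open>Block fading channel coefficients G(r,t,b) for blocks b (spatially i.i.d.,
  i.i.d. across blocks, common distribution mu). The channel at time k is G(r,t,k div L).
  Blocks b < n suffice for a codeword of length n.\<close>
definition fadeM :: "complex measure \<Rightarrow> 'r set \<Rightarrow> 't set \<Rightarrow> nat \<Rightarrow> (('r \<times> 't \<times> nat) \<Rightarrow> complex) measure" where
  "fadeM mu Rx Tx n = PiM (Rx \<times> Tx \<times> {..<n}) (\<lambda>_. mu)"

definition msgs :: "'m set \<Rightarrow> ('m \<Rightarrow> nat) \<Rightarrow> ('m \<Rightarrow> nat) set" where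
  "msgs W M = PiE W (\<lambda>w. {..<M w})"

definition cb_out :: "'t set \<Rightarrow> ('r \<Rightarrow> 't \<Rightarrow> bool) \<Rightarrow> nat \<Rightarrow> nat \<Rightarrow>
    ('t \<Rightarrow> ('m \<Rightarrow> nat) \<Rightarrow> nat \<Rightarrow> complex) \<Rightarrow> ('m \<Rightarrow> nat) \<Rightarrow> 'r \<Rightarrow>
    (('r \<times> 't \<times> nat) \<Rightarrow> complex) \<Rightarrow> (('r \<times> nat) \<Rightarrow> complex) \<Rightarrow> nat \<Rightarrow> complex" where
  "cb_out Tx c L n enc m r G Z k =
     (if k < n then (\<Sum>t\<in>{t\<in>Tx. c r t}. G (r, t, k div L) * enc t m k) + Z (r, k) else 0)"

definition cb_csi :: "'t set \<Rightarrow> ('r \<Rightarrow> 't \<Rightarrow> bool) \<Rightarrow> nat \<Rightarrow> nat \<Rightarrow> 'r \<Rightarrow>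
    (('r \<times> 't \<times> nat) \<Rightarrow> complex) \<Rightarrow> 't \<Rightarrow> nat \<Rightarrow> complex" where
  "cb_csi Tx c L n r G t k = (if t \<in> Tx \<and> c r t \<and> k < n then G (r, t, k div L) else 0)"

definition cb_space :: "complex measure \<Rightarrow> 'r set \<Rightarrow> 't set \<Rightarrow> nat \<Rightarrow>
    ((('r \<times> 't \<times> nat) \<Rightarrow> complex) \<times> (('r \<times> nat) \<Rightarrow> complex)) measure" where
  "cb_space mu Rx Tx n = fadeM mu Rx Tx n \<Otimes>\<^sub>M noiseM Rx n"

definition cb_err :: "'t set \<Rightarrow> 'r set \<Rightarrow> ('r \<Rightarrow> 'm set) \<Rightarrow> ('r \<Rightarrow> 't \<Rightarrow> bool) \<Rightarrow>
    complex measure \<Rightarrow> nat \<Rightarrow> nat \<Rightarrow>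
    ('t \<Rightarrow> ('m \<Rightarrow> nat) \<Rightarrow> nat \<Rightarrow> complex) \<Rightarrow>
    ('r \<Rightarrow> (nat \<Rightarrow> complex) \<Rightarrow> ('t \<Rightarrow> nat \<Rightarrow> complex) \<Rightarrow> 'm \<Rightarrow> nat) \<Rightarrow> ('m \<Rightarrow> nat) \<Rightarrow>
    ((('r \<times> 't \<times> nat) \<Rightarrow> complex) \<times> (('r \<times> nat) \<Rightarrow> complex)) set" where
  "cb_err Tx Rx Wr c mu L n enc dec m =
     {(G, Z) \<in> space (cb_space mu Rx Tx n).
        \<exists>r\<in>Rx. \<exists>w\<in>Wr r. dec r (cb_out Tx c L n enc m r G Z) (cb_csi Tx c L n r G) w \<noteq> m w}"

definition cb_code :: "'t set \<Rightarrow> 'r set \<Rightarrow> 'm set \<Rightarrow> ('t \<Rightarrow> 'm set) \<Rightarrow> ('r \<Rightarrow> 'm set) \<Rightarrow>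
    ('r \<Rightarrow> 't \<Rightarrow> bool) \<Rightarrow> complex measure \<Rightarrow> nat \<Rightarrow> real \<Rightarrow> nat \<Rightarrow> ('m \<Rightarrow> nat) \<Rightarrow>
    ('t \<Rightarrow> ('m \<Rightarrow> nat) \<Rightarrow> nat \<Rightarrow> complex) \<Rightarrow>
    ('r \<Rightarrow> (nat \<Rightarrow> complex) \<Rightarrow> ('t \<Rightarrow> nat \<Rightarrow> complex) \<Rightarrow> 'm \<Rightarrow> nat) \<Rightarrow> bool" where
  "cb_code Tx Rx W Wt Wr c mu L P n M enc dec \<longleftrightarrow>
     (\<forall>w\<in>W. 1 \<le> M w) \<and>
     (\<forall>t\<in>Tx. \<forall>m\<in>msgs W M. \<forall>m'\<in>msgs W M. (\<forall>w\<in>Wt t. m w = m' w) \<longrightarrow> enc t m = enc t m') \<and>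
     (\<forall>t\<in>Tx. \<forall>m\<in>msgs W M. (\<Sum>k<n. (cmod (enc t m k))\<^sup>2) \<le> real n * P) \<and>
     (\<forall>m\<in>msgs W M. cb_err Tx Rx Wr c mu L n enc dec m \<in> sets (cb_space mu Rx Tx n))"

definition cb_pe :: "'t set \<Rightarrow> 'r set \<Rightarrow> 'm set \<Rightarrow> ('r \<Rightarrow> 'm set) \<Rightarrow>
    ('r \<Rightarrow> 't \<Rightarrow> bool) \<Rightarrow> complex measure \<Rightarrow> nat \<Rightarrow> nat \<Rightarrow> ('m \<Rightarrow> nat) \<Rightarrow>
    ('t \<Rightarrow> ('m \<Rightarrow> nat) \<Rightarrow> nat \<Rightarrow> complex) \<Rightarrow>
    ('r \<Rightarrow> (nat \<Rightarrow> complex) \<Rightarrow> ('t \<Rightarrow> nat \<Rightarrow> complex) \<Rightarrow> 'm \<Rightarrow> nat) \<Rightarrow> real" where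
  "cb_pe Tx Rx W Wr c mu L n M enc dec =
     (\<Sum>m\<in>msgs W M. measure (cb_space mu Rx Tx n) (cb_err Tx Rx Wr c mu L n enc dec m))
       / real (card (msgs W M))"

text \<open>Achievable rate tuple (rates in bits per channel use), closure built in.\<close>
definition cb_achievable :: "'t set \<Rightarrow> 'r set \<Rightarrow> 'm set \<Rightarrow> ('t \<Rightarrow> 'm set) \<Rightarrow> ('r \<Rightarrow> 'm set) \<Rightarrow>
    ('r \<Rightarrow> 't \<Rightarrow> bool) \<Rightarrow> complex measure \<Rightarrow> nat \<Rightarrow> real \<Rightarrow> ('m \<Rightarrow> real) \<Rightarrow> bool" where
  "cb_achievable Tx Rx W Wt Wr c mu L P Rt \<longleftrightarrow>
     (\<forall>w\<in>W. 0 \<le> Rt w) \<and>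
     (\<forall>\<epsilon>>0. \<forall>N. \<exists>n\<ge>N. \<exists>M enc dec.
        cb_code Tx Rx W Wt Wr c mu L P n M enc dec \<and>
        (\<forall>w\<in>W. real n * (Rt w - \<epsilon>) \<le> log 2 (real (M w))) \<and>
        cb_pe Tx Rx W Wr c mu L n M enc dec \<le> \<epsilon>)"

definition cb_sumcap :: "'t set \<Rightarrow> 'r set \<Rightarrow> 'm set \<Rightarrow> ('t \<Rightarrow> 'm set) \<Rightarrow> ('r \<Rightarrow> 'm set) \<Rightarrow>
    ('r \<Rightarrow> 't \<Rightarrow> bool) \<Rightarrow> complex measure \<Rightarrow> nat \<Rightarrow> real \<Rightarrow> ereal" where
  "cb_sumcap Tx Rx W Wt Wr c mu L P =
     (SUP Rt\<in>{Rt. cb_achievable Tx Rx W Wt Wr c mu L P Rt}. \<Sum>w\<in>W. ereal (Rt w))"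

definition cb_dof :: "'t set \<Rightarrow> 'r set \<Rightarrow> 'm set \<Rightarrow> ('t \<Rightarrow> 'm set) \<Rightarrow> ('r \<Rightarrow> 'm set) \<Rightarrow>
    ('r \<Rightarrow> 't \<Rightarrow> bool) \<Rightarrow> complex measure \<Rightarrow> nat \<Rightarrow> ereal" where
  "cb_dof Tx Rx W Wt Wr c mu L =
     Limsup at_top (\<lambda>P. cb_sumcap Tx Rx W Wt Wr c mu L P / ereal (log 2 P))"

definition gic_out :: "nat \<Rightarrow> (('m \<Rightarrow> nat) \<Rightarrow> nat \<Rightarrow> complex) \<Rightarrow> ('m \<Rightarrow> nat) \<Rightarrow> 'r \<Rightarrow>
    (('r \<times> nat) \<Rightarrow> complex) \<Rightarrow> nat \<Rightarrow> complex" where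
  "gic_out n enc m r Z k = (if k < n then enc m k + Z (r, k) else 0)"

definition side :: "('r \<Rightarrow> 'm set) \<Rightarrow> 'r \<Rightarrow> ('m \<Rightarrow> nat) \<Rightarrow> 'm \<Rightarrow> nat" where
  "side Wb r m = (\<lambda>w. if w \<in> Wb r then m w else 0)"

definition gic_err :: "'r set \<Rightarrow> ('r \<Rightarrow> 'm set) \<Rightarrow> ('r \<Rightarrow> 'm set) \<Rightarrow> nat \<Rightarrow>
    (('m \<Rightarrow> nat) \<Rightarrow> nat \<Rightarrow> complex) \<Rightarrow>
    ('r \<Rightarrow> (nat \<Rightarrow> complex) \<Rightarrow> ('m \<Rightarrow> nat) \<Rightarrow> 'm \<Rightarrow> nat) \<Rightarrow> ('m \<Rightarrow> nat) \<Rightarrow>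
    (('r \<times> nat) \<Rightarrow> complex) set" where
  "gic_err Rx Wr Wb n enc dec m =
     {Z \<in> space (noiseM Rx n).
        \<exists>r\<in>Rx. \<exists>w\<in>Wr r. dec r (gic_out n enc m r Z) (side Wb r m) w \<noteq> m w}"

definition gic_code :: "'r set \<Rightarrow> 'm set \<Rightarrow> ('r \<Rightarrow> 'm set) \<Rightarrow> ('r \<Rightarrow> 'm set) \<Rightarrow>
    real \<Rightarrow> nat \<Rightarrow> ('m \<Rightarrow> nat) \<Rightarrow> (('m \<Rightarrow> nat) \<Rightarrow> nat \<Rightarrow> complex) \<Rightarrow>
    ('r \<Rightarrow> (nat \<Rightarrow> complex) \<Rightarrow> ('m \<Rightarrow> nat) \<Rightarrow> 'm \<Rightarrow> nat) \<Rightarrow> bool" where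
  "gic_code Rx W Wr Wb P n M enc dec \<longleftrightarrow>
     (\<forall>w\<in>W. 1 \<le> M w) \<and>
     (\<forall>m\<in>msgs W M. (\<Sum>k<n. (cmod (enc m k))\<^sup>2) \<le> real n * P) \<and>
     (\<forall>m\<in>msgs W M. gic_err Rx Wr Wb n enc dec m \<in> sets (noiseM Rx n))"

definition gic_pe :: "'r set \<Rightarrow> 'm set \<Rightarrow> ('r \<Rightarrow> 'm set) \<Rightarrow> ('r \<Rightarrow> 'm set) \<Rightarrow>
    nat \<Rightarrow> ('m \<Rightarrow> nat) \<Rightarrow> (('m \<Rightarrow> nat) \<Rightarrow> nat \<Rightarrow> complex) \<Rightarrow>
    ('r \<Rightarrow> (nat \<Rightarrow> complex) \<Rightarrow> ('m \<Rightarrow> nat) \<Rightarrow> 'm \<Rightarrow> nat) \<Rightarrow> real" where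
  "gic_pe Rx W Wr Wb n M enc dec =
     (\<Sum>m\<in>msgs W M. measure (noiseM Rx n) (gic_err Rx Wr Wb n enc dec m))
       / real (card (msgs W M))"

definition gic_achievable :: "'r set \<Rightarrow> 'm set \<Rightarrow> ('r \<Rightarrow> 'm set) \<Rightarrow> ('r \<Rightarrow> 'm set) \<Rightarrow>
    real \<Rightarrow> ('m \<Rightarrow> real) \<Rightarrow> bool" where
  "gic_achievable Rx W Wr Wb P Rt \<longleftrightarrow>
     (\<forall>w\<in>W. 0 \<le> Rt w) \<and>
     (\<forall>\<epsilon>>0. \<forall>N. \<exists>n\<ge>N. \<exists>M enc dec.
        gic_code Rx W Wr Wb P n M enc dec \<and>
        (\<forall>w\<in>W. real n * (Rt w - \<epsilon>) \<le> log 2 (real (M w))) \<and>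
        gic_pe Rx W Wr Wb n M enc dec \<le> \<epsilon>)"

definition gic_sumcap :: "'r set \<Rightarrow> 'm set \<Rightarrow> ('r \<Rightarrow> 'm set) \<Rightarrow> ('r \<Rightarrow> 'm set) \<Rightarrow>
    real \<Rightarrow> ereal" where
  "gic_sumcap Rx W Wr Wb P =
     (SUP Rt\<in>{Rt. gic_achievable Rx W Wr Wb P Rt}. \<Sum>w\<in>W. ereal (Rt w))"

definition gic_dof :: "'r set \<Rightarrow> 'm set \<Rightarrow> ('r \<Rightarrow> 'm set) \<Rightarrow> ('r \<Rightarrow> 'm set) \<Rightarrow> ereal" where
  "gic_dof Rx W Wr Wb = Limsup at_top (\<lambda>P. gic_sumcap Rx W Wr Wb P / ereal (log 2 P))"

end

theory Submission
  imports Defs "HOL-Real_Asymp.Real_Asymp"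
begin

text \<open>
  Let all receivers of the index coding problem see one and the same realization \<open>g(t, b)\<close> of the
  fading: the index coding transmitter sends \<open>\<Sum>\<^sub>t g(t, b) X\<^sub>t\<close>. Receiver \<open>r\<close> knows the
  messages of all transmitters that it does not hear in the cellular problem, subtracts their
  contribution, and is left with an output whose law, averaged over \<open>g\<close>, is that of its cellular
  output: under spatially i.i.d. fading only the joint law across receivers has changed. By a union
  bound over receivers some fixed \<open>g\<close> gives an error at most \<open>card Rx\<close> times the cellular one. The
  power grows by a constant factor, which is invisible in the degrees of freedom.
\<close>

section \<open>Gaussian noise, sections of events, averaging\<close>

lemma prob_space_cgauss: "prob_space cgauss"
proof
  \<comment> \<open>\<open>f\<close> is the real normal density of variance 1/2; the density of
    \<open>cgauss\<close> is the product of its values at the real and imaginary parts, so the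
    integral factors.\<close>
  define f where "f = (\<lambda>x::real. ennreal (exp (- x\<^sup>2) / sqrt pi))"
  have 1: "(\<integral>\<^sup>+x. f x \<partial>lborel) = 1"
  proof -
    interpret prob_space "density lborel (normal_density 0 (1 / sqrt 2))"
      by (rule prob_space_normal_density) simp
    have "normal_density 0 (1 / sqrt 2) x = exp (- x\<^sup>2) / sqrt pi" for x
      by (simp add: normal_density_def power_divide)
    then show ?thesis
      using emeasure_space_1 by (simp add: emeasure_density f_def)
  qed
  have "(\<Prod>b\<in>Basis. f (z \<bullet> b)) = ennreal (exp (- (cmod z)\<^sup>2) / pi)" for z :: complex
  proof -
    have "(\<Prod>b\<in>Basis. f (z \<bullet> b)) = f (Re z) * f (Im z)"
      by (simp add: Basis_complex_def)
    also have "\<dots> = ennreal (exp (- (Re z)\<^sup>2) / sqrt pi * (exp (- (Im z)\<^sup>2) / sqrt pi))"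
      unfolding f_def by (rule ennreal_mult[symmetric]) auto
    also have "exp (- (Re z)\<^sup>2) / sqrt pi * (exp (- (Im z)\<^sup>2) / sqrt pi) = exp (- (cmod z)\<^sup>2) / pi"
      by (simp add: cmod_power2 exp_diff exp_minus field_simps exp_add)
    finally show ?thesis .
  qed
  then have "emeasure cgauss (space cgauss) = (\<integral>\<^sup>+z. (\<Prod>b\<in>Basis. f (z \<bullet> b)) \<partial>(lborel :: complex measure))"
    by (simp add: cgauss_def emeasure_density)
  also have "\<dots> = (\<Prod>b\<in>(Basis :: complex set). (\<integral>\<^sup>+x. f x \<partial>lborel))"
    by (rule nn_integral_lborel_prod) (auto simp: f_def)
  finally show "emeasure cgauss (space cgauss) = 1"
    by (simp add: 1)
qed

lemma sets_cgauss [measurable_cong, simp]: "sets cgauss = sets borel"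
  and space_cgauss [simp]: "space cgauss = UNIV"
  by (auto simp: cgauss_def)

lemma prob_space_noiseM: "prob_space (noiseM Rx n)"
  unfolding noiseM_def by (intro prob_space_PiM prob_space_cgauss)

lemma prob_space_fadeM: "prob_space mu \<Longrightarrow> prob_space (fadeM mu Rx Tx n)"
  unfolding fadeM_def by (intro prob_space_PiM)

text \<open>Fubini for an event: a joint error probability is the mean over the fading of the error
  probability at fixed fading.\<close>

lemma
  assumes "prob_space A" "prob_space B" and E: "E \<in> sets (A \<Otimes>\<^sub>M B)"
  shows integrable_measure_section: "integrable A (\<lambda>x. measure B (Pair x -` E))"
    and integral_measure_section:
      "(\<integral>x. measure B (Pair x -` E) \<partial>A) = measure (A \<Otimes>\<^sub>M B) E"
proof -
  interpret A: prob_space A by fact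
  interpret B: prob_space B by fact
  interpret AB: pair_prob_space A B ..
  have [measurable]: "(\<lambda>x. measure B (Pair x -` E)) \<in> borel_measurable A"
    using B.measurable_emeasure_Pair[OF E] unfolding measure_def by measurable
  show int: "integrable A (\<lambda>x. measure B (Pair x -` E))"
    by (rule A.integrable_const_bound[where B=1]) auto
  have "ennreal (\<integral>x. measure B (Pair x -` E) \<partial>A) = (\<integral>\<^sup>+x. emeasure B (Pair x -` E) \<partial>A)"
    by (subst nn_integral_eq_integral[symmetric, OF int]) (auto simp: B.emeasure_eq_measure)
  also have "\<dots> = ennreal (measure (A \<Otimes>\<^sub>M B) E)"
    using B.emeasure_pair_measure_alt[OF E] by (simp add: AB.emeasure_eq_measure)
  finally show "(\<integral>x. measure B (Pair x -` E) \<partial>A) = measure (A \<Otimes>\<^sub>M B) E"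
    by (simp add: Bochner_Integration.integral_nonneg)
qed

text \<open>Derandomization: otherwise \<open>X\<close> would almost surely exceed its own
  expectation. \<open>Q\<close> lets the chosen point also obey an almost sure constraint, later the
  magnitude bound on the fading.\<close>

lemma (in prob_space) exists_le_expectation:
  fixes X :: "'a \<Rightarrow> real"
  assumes "integrable M X" and "AE x in M. Q x"
  shows "\<exists>x\<in>space M. Q x \<and> X x \<le> expectation X"
proof (rule ccontr)
  assume *: "\<not> (\<exists>x\<in>space M. Q x \<and> X x \<le> expectation X)"
  have "AE x in M. expectation X < X x"
    using assms(2) AE_space by eventually_elim (use * in force)
  from expectation_greater[OF assms(1) this] show False by simp
qed

section \<open>The index code built from a fixed cellular code\<close>

locale cellular_code =
  fixes Tx :: "'t set" and Rx :: "'r set" and W :: "'m set"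
    and Wt :: "'t \<Rightarrow> 'm set" and Wr :: "'r \<Rightarrow> 'm set"
    and c :: "'r \<Rightarrow> 't \<Rightarrow> bool"
    and mu :: "complex measure" and L :: nat and b P :: real and n :: nat
    and M :: "'m \<Rightarrow> nat" and enc :: "'t \<Rightarrow> ('m \<Rightarrow> nat) \<Rightarrow> nat \<Rightarrow> complex"
    and dec :: "'r \<Rightarrow> (nat \<Rightarrow> complex) \<Rightarrow> ('t \<Rightarrow> nat \<Rightarrow> complex) \<Rightarrow> 'm \<Rightarrow> nat"
  assumes finite_Tx: "finite Tx" and finite_Rx: "finite Rx"
    and Wt_subset: "\<And>t. t \<in> Tx \<Longrightarrow> Wt t \<subseteq> W"
    and Wr_subset: "\<And>r. r \<in> Rx \<Longrightarrow> Wr r \<subseteq> W"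
    and prob_mu: "prob_space mu" and sets_mu [measurable_cong, simp]: "sets mu = sets borel"
    and bound_mu: "AE z in mu. cmod z \<le> b"
    and code: "cb_code Tx Rx W Wt Wr c mu L P n M enc dec"
begin

lemma space_mu [simp]: "space mu = UNIV"
  using sets_eq_imp_space_eq[OF sets_mu] by simp

abbreviation "fade1 \<equiv> PiM (Tx \<times> {..<n}) (\<lambda>_. mu)"

definition common :: "('t \<times> nat \<Rightarrow> complex) \<Rightarrow> 'r \<times> 't \<times> nat \<Rightarrow> complex" where
  "common g = (\<lambda>(r, t, i). g (t, i))"

definition correct :: "'r \<Rightarrow> ('m \<Rightarrow> nat) \<Rightarrow> ('r \<times> 't \<times> nat \<Rightarrow> complex) \<Rightarrow> ('r \<times> nat \<Rightarrow> complex) \<Rightarrow> bool" where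
  "correct r m G Z \<longleftrightarrow>
     (\<forall>w\<in>Wr r. dec r (cb_out Tx c L n enc m r G Z) (cb_csi Tx c L n r G) w = m w)"

abbreviation "err m \<equiv> cb_err Tx Rx Wr c mu L n enc dec m"

text \<open>That is, some realization of fading and noise makes all receivers succeed at once. It is
  used to isolate one receiver in the joint error event; if there is none, the cellular error
  probability is 1.\<close>

definition decodable :: "('m \<Rightarrow> nat) \<Rightarrow> bool" where
  "decodable m \<longleftrightarrow> err m \<noteq> space (cb_space mu Rx Tx n)"

definition incorrect1 :: "'r \<Rightarrow> ('m \<Rightarrow> nat) \<Rightarrow> (('t \<times> nat \<Rightarrow> complex) \<times> ('r \<times> nat \<Rightarrow> complex)) set" where
  "incorrect1 r m = {(g, Z) \<in> space (fade1 \<Otimes>\<^sub>M noiseM Rx n). \<not> correct r m (common g) Z}"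

definition enc1 :: "('t \<times> nat \<Rightarrow> complex) \<Rightarrow> ('m \<Rightarrow> nat) \<Rightarrow> nat \<Rightarrow> complex" where
  "enc1 g m k = (\<Sum>t\<in>Tx. g (t, k div L) * enc t m k)"

text \<open>Restricting to \<open>W\<close> turns the zero-filled side information into a message
  tuple, to which the encoders of the unheard transmitters apply.\<close>

definition cancel :: "('t \<times> nat \<Rightarrow> complex) \<Rightarrow> 'r \<Rightarrow> (nat \<Rightarrow> complex) \<Rightarrow> ('m \<Rightarrow> nat) \<Rightarrow> nat \<Rightarrow> complex" where
  "cancel g r y s k = (if k < n
     then y k - (\<Sum>t\<in>{t\<in>Tx. \<not> c r t}. g (t, k div L) * enc t (restrict s W) k) else 0)"

definition dec0 :: "('t \<times> nat \<Rightarrow> complex) \<Rightarrow> 'r \<Rightarrow> (nat \<Rightarrow> complex) \<Rightarrow> ('m \<Rightarrow> nat) \<Rightarrow> 'm \<Rightarrow> nat" where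
  "dec0 g r y s = dec r (cancel g r y s) (cb_csi Tx c L n r (common g))"

text \<open>
  The joint error event of the cellular code is measurable, but the error events of the single
  receivers need not be: this fails for message tuples on which some receiver always errs. Outputs
  that only occur for such tuples are therefore replaced by \<open>M\<close>, which is never a message.
\<close>

definition dec1 :: "('t \<times> nat \<Rightarrow> complex) \<Rightarrow> 'r \<Rightarrow> (nat \<Rightarrow> complex) \<Rightarrow> ('m \<Rightarrow> nat) \<Rightarrow> 'm \<Rightarrow> nat" where
  "dec1 g r y s = (if \<exists>m\<in>msgs W M. decodable m \<and> (\<forall>w\<in>Wr r. dec0 g r y s w = m w)
     then dec0 g r y s else M)"

abbreviation "Wb r \<equiv> \<Union>{Wt t | t. t \<in> Tx \<and> \<not> c r t}"

section \<open>Decoding after cancellation\<close>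

lemma msgs_less: "m \<in> msgs W M \<Longrightarrow> w \<in> W \<Longrightarrow> m w < M w"
  by (auto simp: msgs_def)

lemma err_eq: "err m = {(G, Z) \<in> space (cb_space mu Rx Tx n). \<exists>r\<in>Rx. \<not> correct r m G Z}"
  by (auto simp: cb_err_def correct_def)

lemma err_sets [measurable]: "m \<in> msgs W M \<Longrightarrow> err m \<in> sets (cb_space mu Rx Tx n)"
  using code by (simp add: cb_code_def)

text \<open>Only the fading and noise of receiver \<open>r\<close> itself enter its decision, and
  the block index \<open>k div L\<close> is at most \<open>k\<close>, hence below
  \<open>n\<close>.\<close>

lemma correct_cong:
  assumes "\<And>t i. t \<in> Tx \<Longrightarrow> i < n \<Longrightarrow> G (r, t, i) = G' (r, t, i)"
    and "\<And>k. k < n \<Longrightarrow> Z (r, k) = Z' (r, k)"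
  shows "correct r m G Z \<longleftrightarrow> correct r m G' Z'"
proof -
  have less: "k div L < n" if "k < n" for k
    using that div_le_dividend le_less_trans by blast
  have "cb_out Tx c L n enc m r G Z = cb_out Tx c L n enc m r G' Z'"
    by (auto simp: cb_out_def assms less fun_eq_iff)
  moreover have "cb_csi Tx c L n r G = cb_csi Tx c L n r G'"
    by (auto simp: cb_csi_def assms less fun_eq_iff)
  ultimately show ?thesis
    by (simp add: correct_def)
qed

text \<open>An encoder depends only on the messages of its own transmitter, so the side information
  reproduces the unheard part of the sent sum exactly.\<close>

lemma cancel_gic_out:
  assumes "m \<in> msgs W M"
  shows "cancel g r (gic_out n (enc1 g) m r Z) (side Wb r m) = cb_out Tx c L n enc m r (common g) Z"
proof
  fix k
  let ?s = "restrict (side Wb r m) W"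
  \<comment> \<open>The filler 0 is a legal message value because
    \<open>1 \<le> M w\<close>.\<close>
  have s: "?s \<in> msgs W M"
    unfolding msgs_def
  proof (rule restrict_PiE_iff[THEN iffD2], rule ballI)
    fix w assume w: "w \<in> W"
    then have "1 \<le> M w"
      using code by (simp add: cb_code_def)
    then show "side Wb r m w \<in> {..<M w}"
      using msgs_less[OF assms w] by (simp add: side_def)
  qed
  have eq: "enc t ?s = enc t m" if "t \<in> Tx" "\<not> c r t" for t
  proof -
    have "\<forall>w\<in>Wt t. ?s w = m w"
      using that Wt_subset[of t] by (auto simp: side_def)
    then show ?thesis
      using code s assms that unfolding cb_code_def by blast
  qed
  have "{t\<in>Tx. c r t} \<union> {t\<in>Tx. \<not> c r t} = Tx" by auto
  then have "enc1 g m k = (\<Sum>t\<in>{t\<in>Tx. c r t}. g (t, k div L) * enc t m k)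
      + (\<Sum>t\<in>{t\<in>Tx. \<not> c r t}. g (t, k div L) * enc t m k)"
    unfolding enc1_def using finite_Tx
    by (subst sum.union_disjoint[symmetric]) auto
  moreover have "(\<Sum>t\<in>{t\<in>Tx. \<not> c r t}. g (t, k div L) * enc t ?s k)
      = (\<Sum>t\<in>{t\<in>Tx. \<not> c r t}. g (t, k div L) * enc t m k)"
    by (rule sum.cong) (auto simp: eq)
  ultimately show "cancel g r (gic_out n (enc1 g) m r Z) (side Wb r m) k
      = cb_out Tx c L n enc m r (common g) Z k"
    by (simp add: cancel_def gic_out_def cb_out_def common_def)
qed

text \<open>\<open>M w\<close> differs from every legal \<open>m w\<close>, so a replaced output is
  wrong at each desired message, and a correct output survives only if a decodable tuple has the
  same desired messages.\<close>

lemma dec1_correct_iff: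
  assumes m: "m \<in> msgs W M" and r: "r \<in> Rx"
  shows "(\<forall>w\<in>Wr r. dec1 g r (gic_out n (enc1 g) m r Z) (side Wb r m) w = m w) \<longleftrightarrow>
    correct r m (common g) Z \<and>
    (Wr r = {} \<or> (\<exists>m'\<in>msgs W M. decodable m' \<and> (\<forall>w\<in>Wr r. m' w = m w)))"
proof -
  have ok: "correct r m (common g) Z \<longleftrightarrow>
      (\<forall>w\<in>Wr r. dec0 g r (gic_out n (enc1 g) m r Z) (side Wb r m) w = m w)"
    by (simp add: correct_def dec0_def cancel_gic_out[OF m])
  have "M w \<noteq> m w" if "w \<in> Wr r" for w
    using msgs_less[OF m, of w] Wr_subset[OF r] that by auto
  then show ?thesis
    unfolding ok dec1_def by auto
qed

section \<open>Measurability of the error events\<close>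

text \<open>At fixed \<open>g\<close>, passing from \<open>m\<close> to \<open>m'\<close> translates
  the output of \<open>r\<close> by a deterministic signal, which the noise can absorb. This carries
  measurability from decodable tuples to all tuples sharing their desired messages.\<close>

lemma correct_shift:
  assumes r: "r \<in> Rx" and m': "\<And>w. w \<in> Wr r \<Longrightarrow> m' w = m w"
  shows "correct r m (common g) Z \<longleftrightarrow> correct r m' (common g)
    (\<lambda>(r', k)\<in>Rx \<times> {..<n}. Z (r', k) +
      (\<Sum>t\<in>{t\<in>Tx. c r t}. g (t, k div L) * (enc t m k - enc t m' k)))"
    (is "_ \<longleftrightarrow> correct r m' _ ?Z")
proof -
  have "cb_out Tx c L n enc m r (common g) Z = cb_out Tx c L n enc m' r (common g) ?Z"
    using r by (auto simp: fun_eq_iff cb_out_def common_def sum.distrib[symmetric] algebra_simps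
      intro!: sum.cong)
  then show ?thesis
    by (auto simp: correct_def m')
qed

text \<open>Freeze all other receivers at a realization where they decode correctly, which
  decodability supplies; the joint error then occurs exactly if \<open>r\<close> errs. So the event
  is a preimage of \<open>err m\<close> under the measurable map \<open>S\<close>.\<close>

lemma incorrect1_sets:
  assumes m: "m \<in> msgs W M" "decodable m" and r: "r \<in> Rx"
  shows "incorrect1 r m \<in> sets (fade1 \<Otimes>\<^sub>M noiseM Rx n)"
proof -
  obtain G0 Z0 where 0: "(G0, Z0) \<in> space (cb_space mu Rx Tx n)" "\<And>r. r \<in> Rx \<Longrightarrow> correct r m G0 Z0"
    using m(2) unfolding decodable_def err_eq by auto
  define S where "S = (\<lambda>(g, Z).
    (\<lambda>j\<in>Rx \<times> Tx \<times> {..<n}. if fst j = r then g (snd j) else G0 j,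
     \<lambda>j\<in>Rx \<times> {..<n}. if fst j = r then Z j else Z0 j))"
  have S [measurable]: "S \<in> (fade1 \<Otimes>\<^sub>M noiseM Rx n) \<rightarrow>\<^sub>M cb_space mu Rx Tx n"
    unfolding S_def cb_space_def fadeM_def noiseM_def case_prod_beta'
  proof (intro measurable_Pair measurable_restrict)
    fix j :: "'r \<times> 't \<times> nat" assume j: "j \<in> Rx \<times> Tx \<times> {..<n}"
    then have "snd j \<in> Tx \<times> {..<n}" by auto
    then show "(\<lambda>x. if fst j = r then fst x (snd j) else G0 j)
        \<in> (fade1 \<Otimes>\<^sub>M Pi\<^sub>M (Rx \<times> {..<n}) (\<lambda>_. cgauss)) \<rightarrow>\<^sub>M mu"
      by (cases "fst j = r") (simp_all, measurable)
  next
    fix j :: "'r \<times> nat" assume j: "j \<in> Rx \<times> {..<n}"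
    then show "(\<lambda>x. if fst j = r then snd x j else Z0 j)
        \<in> (fade1 \<Otimes>\<^sub>M Pi\<^sub>M (Rx \<times> {..<n}) (\<lambda>_. cgauss)) \<rightarrow>\<^sub>M cgauss"
      by (cases "fst j = r") (simp_all, measurable)
  qed
  have correct_S: "(\<exists>r'\<in>Rx. \<not> correct r' m (fst (S (g, Z))) (snd (S (g, Z)))) \<longleftrightarrow> \<not> correct r m (common g) Z"
    for g Z
  proof -
    have "correct r m (fst (S (g, Z))) (snd (S (g, Z))) \<longleftrightarrow> correct r m (common g) Z"
      using r by (intro correct_cong) (auto simp: S_def common_def)
    moreover have "correct r' m (fst (S (g, Z))) (snd (S (g, Z))) \<longleftrightarrow> correct r' m G0 Z0"
      if "r' \<in> Rx" "r' \<noteq> r" for r'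
      using that by (intro correct_cong) (auto simp: S_def)
    ultimately show ?thesis
      using 0(2) r by auto
  qed
  have "S x \<in> err m \<longleftrightarrow> x \<in> incorrect1 r m" if x: "x \<in> space (fade1 \<Otimes>\<^sub>M noiseM Rx n)" for x
  proof (cases x)
    case (Pair g Z)
    have "S x \<in> err m \<longleftrightarrow> (\<exists>r'\<in>Rx. \<not> correct r' m (fst (S x)) (snd (S x)))"
      using measurable_space[OF S x] by (simp add: err_eq case_prod_beta')
    also have "\<dots> \<longleftrightarrow> \<not> correct r m (common g) Z"
      unfolding Pair by (rule correct_S)
    finally show ?thesis
      using x by (simp add: incorrect1_def Pair)
  qed
  moreover have "incorrect1 r m \<subseteq> space (fade1 \<Otimes>\<^sub>M noiseM Rx n)"
    by (auto simp: incorrect1_def)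
  ultimately have "S -` err m \<inter> space (fade1 \<Otimes>\<^sub>M noiseM Rx n) = incorrect1 r m"
    by blast
  then show ?thesis
    using measurable_sets[OF S err_sets[OF m(1)]] by simp
qed

text \<open>Projecting the fading to the coordinates of \<open>r\<close> pulls the event back into
  \<open>err m\<close>, because \<open>r\<close> sees the same output as before.\<close>

lemma measure_incorrect1_le:
  assumes m: "m \<in> msgs W M" "decodable m" and r: "r \<in> Rx"
  shows "measure (fade1 \<Otimes>\<^sub>M noiseM Rx n) (incorrect1 r m) \<le> measure (cb_space mu Rx Tx n) (err m)"
proof -
  interpret F: prob_space "fadeM mu Rx Tx n" by (rule prob_space_fadeM[OF prob_mu])
  interpret N: prob_space "noiseM Rx n" by (rule prob_space_noiseM)
  interpret FN: pair_prob_space "fadeM mu Rx Tx n" "noiseM Rx n" ..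
  define p :: "('r \<times> 't \<times> nat \<Rightarrow> complex) \<Rightarrow> _" where "p = (\<lambda>G. \<lambda>j\<in>Tx \<times> {..<n}. G (r, j))"
  have p [measurable]: "p \<in> fadeM mu Rx Tx n \<rightarrow>\<^sub>M fade1"
    unfolding p_def fadeM_def by (intro measurable_restrict measurable_component_singleton) (use r in auto)
  \<comment> \<open>Spatially i.i.d. fading enters here: the coordinates of any one receiver have
    the law \<open>fade1\<close>.\<close>
  have dp: "distr (fadeM mu Rx Tx n) fade1 p = fade1"
    unfolding p_def fadeM_def
    by (rule distr_PiM_reindex[where f="Pair r"]) (use r prob_mu in \<open>auto simp: inj_on_def\<close>)
  have pZ: "(\<lambda>(G, Z). (p G, Z)) \<in> cb_space mu Rx Tx n \<rightarrow>\<^sub>M fade1 \<Otimes>\<^sub>M noiseM Rx n"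
    unfolding cb_space_def by measurable
  have "fade1 \<Otimes>\<^sub>M noiseM Rx n
      = distr (fadeM mu Rx Tx n) fade1 p \<Otimes>\<^sub>M distr (noiseM Rx n) (noiseM Rx n) (\<lambda>x. x)"
    by (simp add: dp distr_id2)
  also have "\<dots> = distr (cb_space mu Rx Tx n) (fade1 \<Otimes>\<^sub>M noiseM Rx n) (\<lambda>(G, Z). (p G, Z))"
    unfolding cb_space_def
    by (rule pair_measure_distr) (auto simp: distr_id2 N.sigma_finite_measure_axioms)
  finally have eq: "fade1 \<Otimes>\<^sub>M noiseM Rx n
      = distr (cb_space mu Rx Tx n) (fade1 \<Otimes>\<^sub>M noiseM Rx n) (\<lambda>(G, Z). (p G, Z))" .
  have "measure (fade1 \<Otimes>\<^sub>M noiseM Rx n) (incorrect1 r m)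
      = measure (cb_space mu Rx Tx n) ((\<lambda>(G, Z). (p G, Z)) -` incorrect1 r m \<inter> space (cb_space mu Rx Tx n))"
    using incorrect1_sets[OF m r]
    by (subst eq) (rule measure_distr[OF pZ])
  also have "\<dots> \<le> measure (cb_space mu Rx Tx n) (err m)"
    unfolding cb_space_def
  proof (rule FN.finite_measure_mono)
    show "(\<lambda>(G, Z). (p G, Z)) -` incorrect1 r m \<inter> space (fadeM mu Rx Tx n \<Otimes>\<^sub>M noiseM Rx n) \<subseteq> err m"
    proof clarify
      fix G Z
      assume *: "(G, Z) \<in> space (fadeM mu Rx Tx n \<Otimes>\<^sub>M noiseM Rx n)" "(p G, Z) \<in> incorrect1 r m"
      have "correct r m (common (p G)) Z \<longleftrightarrow> correct r m G Z"
        by (rule correct_cong) (auto simp: common_def p_def)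
      with * show "(G, Z) \<in> err m"
        using r by (auto simp: err_eq incorrect1_def cb_space_def)
    qed
    show "err m \<in> sets (fadeM mu Rx Tx n \<Otimes>\<^sub>M noiseM Rx n)"
      using err_sets[OF m(1)] by (simp add: cb_space_def)
  qed
  finally show ?thesis .
qed

lemma incorrect_sets_decodable:
  assumes m: "m \<in> msgs W M" "decodable m" and r: "r \<in> Rx" and g: "g \<in> space fade1"
  shows "{Z \<in> space (noiseM Rx n). \<not> correct r m (common g) Z} \<in> sets (noiseM Rx n)"
proof -
  have "{Z \<in> space (noiseM Rx n). \<not> correct r m (common g) Z} = Pair g -` incorrect1 r m"
    using g by (auto simp: incorrect1_def space_pair_measure)
  then show ?thesis
    using sets_Pair1[OF incorrect1_sets[OF m r]] by simp
qed

lemma gic_err_sets: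
  assumes m: "m \<in> msgs W M" and g: "g \<in> space fade1"
  shows "gic_err Rx Wr Wb n (enc1 g) (dec1 g) m \<in> sets (noiseM Rx n)"
proof -
  have "{Z \<in> space (noiseM Rx n). \<not> (\<forall>w\<in>Wr r. dec1 g r (gic_out n (enc1 g) m r Z) (side Wb r m) w = m w)}
      \<in> sets (noiseM Rx n)" (is "?E \<in> _") if r: "r \<in> Rx" for r
  proof (cases "Wr r \<noteq> {} \<and> (\<exists>m'\<in>msgs W M. decodable m' \<and> (\<forall>w\<in>Wr r. m' w = m w))")
    case False
    \<comment> \<open>Either nothing is desired and no error is possible, or no decodable tuple fits
      and every output is wrong.\<close>
    then have "?E = {} \<or> ?E = space (noiseM Rx n)"
      unfolding dec1_correct_iff[OF m r] by (auto simp: correct_def)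
    then show ?thesis by (elim disjE) (simp_all only: sets.empty_sets sets.top)
  next
    case True
    then obtain m' where m': "m' \<in> msgs W M" "decodable m'" "\<And>w. w \<in> Wr r \<Longrightarrow> m' w = m w"
      by blast
    define S where "S = (\<lambda>Z. \<lambda>(r', k)\<in>Rx \<times> {..<n}. Z (r', k) +
      (\<Sum>t\<in>{t\<in>Tx. c r t}. g (t, k div L) * (enc t m k - enc t m' k)))"
    have S [measurable]: "S \<in> noiseM Rx n \<rightarrow>\<^sub>M noiseM Rx n"
      unfolding S_def noiseM_def case_prod_beta' by (rule measurable_restrict) (auto, measurable)
    \<comment> \<open>The event for \<open>m\<close> is a translate of the one for the decodable
      \<open>m'\<close>, whose measurability is known.\<close>
    have "?E = S -` {Z \<in> space (noiseM Rx n). \<not> correct r m' (common g) Z} \<inter> space (noiseM Rx n)"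
      unfolding dec1_correct_iff[OF m r] using True measurable_space[OF S]
      by (auto simp: correct_shift[OF r m'(3)] S_def)
    then show ?thesis
      using measurable_sets[OF S incorrect_sets_decodable[OF m'(1,2) r g]] by simp
  qed
  then have "(\<Union>r\<in>Rx. {Z \<in> space (noiseM Rx n). \<not> (\<forall>w\<in>Wr r. dec1 g r (gic_out n (enc1 g) m r Z) (side Wb r m) w = m w)})
      \<in> sets (noiseM Rx n)"
    using finite_Rx by blast
  also have "(\<Union>r\<in>Rx. {Z \<in> space (noiseM Rx n). \<not> (\<forall>w\<in>Wr r. dec1 g r (gic_out n (enc1 g) m r Z) (side Wb r m) w = m w)})
      = gic_err Rx Wr Wb n (enc1 g) (dec1 g) m"
    by (auto simp: gic_err_def)
  finally show ?thesis .
qed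

section \<open>Error probability, power and choice of the fading realization\<close>

lemma measure_gic_err_le:
  assumes m: "m \<in> msgs W M" "decodable m" and g: "g \<in> space fade1"
  shows "measure (noiseM Rx n) (gic_err Rx Wr Wb n (enc1 g) (dec1 g) m)
    \<le> (\<Sum>r\<in>Rx. measure (noiseM Rx n) (Pair g -` incorrect1 r m))"
proof -
  interpret N: prob_space "noiseM Rx n" by (rule prob_space_noiseM)
  have sets: "Pair g -` incorrect1 r m \<in> sets (noiseM Rx n)" if "r \<in> Rx" for r
    using sets_Pair1[OF incorrect1_sets[OF m that]] .
  have "gic_err Rx Wr Wb n (enc1 g) (dec1 g) m \<subseteq> (\<Union>r\<in>Rx. Pair g -` incorrect1 r m)"
  proof
    fix Z assume "Z \<in> gic_err Rx Wr Wb n (enc1 g) (dec1 g) m"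
    then obtain r where r: "r \<in> Rx" "Z \<in> space (noiseM Rx n)"
      "\<not> (\<forall>w\<in>Wr r. dec1 g r (gic_out n (enc1 g) m r Z) (side Wb r m) w = m w)"
      by (auto simp: gic_err_def)
    \<comment> \<open>\<open>m\<close> itself is the decodable tuple that keeps a correct output
      from being replaced.\<close>
    then have "\<not> correct r m (common g) Z"
      using m unfolding dec1_correct_iff[OF m(1) r(1)] by blast
    with r g show "Z \<in> (\<Union>r\<in>Rx. Pair g -` incorrect1 r m)"
      by (auto simp: incorrect1_def space_pair_measure)
  qed
  then have "measure (noiseM Rx n) (gic_err Rx Wr Wb n (enc1 g) (dec1 g) m)
      \<le> measure (noiseM Rx n) (\<Union>r\<in>Rx. Pair g -` incorrect1 r m)"
    using sets finite_Rx by (intro N.finite_measure_mono) auto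
  also have "\<dots> \<le> (\<Sum>r\<in>Rx. measure (noiseM Rx n) (Pair g -` incorrect1 r m))"
    using sets finite_Rx by (intro N.finite_measure_subadditive_finite) auto
  finally show ?thesis .
qed

text \<open>One factor \<open>card Tx\<close> comes from Cauchy-Schwarz at each time, the other from
  adding the power constraints of the transmitters.\<close>

lemma enc1_power:
  assumes m: "m \<in> msgs W M" and g: "\<And>j. j \<in> Tx \<times> {..<n} \<Longrightarrow> cmod (g j) \<le> b"
  shows "(\<Sum>k<n. (cmod (enc1 g m k))\<^sup>2) \<le> real n * ((b * card Tx)\<^sup>2 * P)"
proof -
  have "(cmod (enc1 g m k))\<^sup>2 \<le> b\<^sup>2 * card Tx * (\<Sum>t\<in>Tx. (cmod (enc t m k))\<^sup>2)" if "k < n" for k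
  proof -
    have less: "k div L < n"
      using that div_le_dividend le_less_trans by blast
    have "cmod (enc1 g m k) \<le> (\<Sum>t\<in>Tx. b * cmod (enc t m k))"
      unfolding enc1_def using g less
      by (intro sum_norm_le) (auto simp: norm_mult intro!: mult_right_mono)
    then have "(cmod (enc1 g m k))\<^sup>2 \<le> (\<Sum>t\<in>Tx. b * cmod (enc t m k))\<^sup>2"
      by (intro power_mono) auto
    also have "\<dots> = b\<^sup>2 * (\<Sum>t\<in>Tx. 1 * cmod (enc t m k))\<^sup>2"
      by (simp add: sum_distrib_left[symmetric] power_mult_distrib)
    also have "(\<Sum>t\<in>Tx. 1 * cmod (enc t m k))\<^sup>2 \<le> (\<Sum>t\<in>Tx. 1\<^sup>2) * (\<Sum>t\<in>Tx. (cmod (enc t m k))\<^sup>2)"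
      by (rule Cauchy_Schwarz_ineq_sum)
    finally show ?thesis
      by (simp add: mult_left_mono mult.assoc)
  qed
  then have "(\<Sum>k<n. (cmod (enc1 g m k))\<^sup>2) \<le> (\<Sum>k<n. b\<^sup>2 * card Tx * (\<Sum>t\<in>Tx. (cmod (enc t m k))\<^sup>2))"
    by (intro sum_mono) auto
  also have "\<dots> = b\<^sup>2 * card Tx * (\<Sum>t\<in>Tx. \<Sum>k<n. (cmod (enc t m k))\<^sup>2)"
    by (subst sum.swap) (simp add: sum_distrib_left)
  also have "(\<Sum>t\<in>Tx. \<Sum>k<n. (cmod (enc t m k))\<^sup>2) \<le> (\<Sum>t\<in>Tx. real n * P)"
    using code m unfolding cb_code_def by (intro sum_mono) blast
  finally have "(\<Sum>k<n. (cmod (enc1 g m k))\<^sup>2) \<le> b\<^sup>2 * card Tx * (\<Sum>t\<in>Tx. real n * P)"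
    by (simp add: mult_left_mono)
  then show ?thesis
    by (simp add: power2_eq_square algebra_simps)
qed

lemma exists_gic_code:
  "\<exists>enc' dec'. gic_code Rx W Wr Wb ((b * card Tx)\<^sup>2 * P) n M enc' dec' \<and>
     gic_pe Rx W Wr Wb n M enc' dec' \<le> (real (card Rx) + 1) * cb_pe Tx Rx W Wr c mu L n M enc dec"
proof -
  interpret F1: prob_space fade1 by (intro prob_space_PiM prob_mu)
  interpret N: prob_space "noiseM Rx n" by (rule prob_space_noiseM)
  interpret F: prob_space "fadeM mu Rx Tx n" by (rule prob_space_fadeM[OF prob_mu])
  interpret FN: pair_prob_space "fadeM mu Rx Tx n" "noiseM Rx n" ..
  \<comment> \<open>\<open>h m g\<close> bounds the index coding error at fixed \<open>g\<close>. An
    undecodable tuple is charged the trivial bound 1, which equals its cellular error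
    probability.\<close>
  define h where "h m g = (if decodable m
    then \<Sum>r\<in>Rx. measure (noiseM Rx n) (Pair g -` incorrect1 r m) else 1)" for m g
  have int: "integrable fade1 (h m)" if "m \<in> msgs W M" for m
    using that integrable_measure_section[OF F1.prob_space_axioms N.prob_space_axioms incorrect1_sets]
    by (cases "decodable m") (auto simp: h_def[abs_def])
  have exp: "F1.expectation (h m) \<le> (real (card Rx) + 1) * measure (cb_space mu Rx Tx n) (err m)"
    if m: "m \<in> msgs W M" for m
  proof (cases "decodable m")
    case True
    have "F1.expectation (h m) = (\<Sum>r\<in>Rx. measure (fade1 \<Otimes>\<^sub>M noiseM Rx n) (incorrect1 r m))"
      using integrable_measure_section[OF F1.prob_space_axioms N.prob_space_axioms incorrect1_sets]
        integral_measure_section[OF F1.prob_space_axioms N.prob_space_axioms incorrect1_sets] m True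
      by (simp add: h_def[abs_def])
    also have "\<dots> \<le> (\<Sum>r\<in>Rx. measure (cb_space mu Rx Tx n) (err m))"
      using m True by (intro sum_mono measure_incorrect1_le)
    also have "\<dots> \<le> (real (card Rx) + 1) * measure (cb_space mu Rx Tx n) (err m)"
      by (simp add: distrib_right)
    finally show ?thesis .
  next
    case False
    then have "measure (cb_space mu Rx Tx n) (err m) = 1"
      using FN.prob_space by (simp add: decodable_def cb_space_def)
    with False show ?thesis
      by (simp add: h_def[abs_def] F1.prob_space)
  qed
  have "AE g in fade1. \<forall>j\<in>Tx \<times> {..<n}. cmod (g j) \<le> b"
    using finite_Tx prob_mu bound_mu
    by (intro AE_finite_allI AE_PiM_component) auto
  \<comment> \<open>The error is summed over all tuples before \<open>g\<close> is chosen, so one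
    realization serves the whole code and also obeys the magnitude bound.\<close>
  then obtain g where g: "g \<in> space fade1" "\<And>j. j \<in> Tx \<times> {..<n} \<Longrightarrow> cmod (g j) \<le> b"
    "(\<Sum>m\<in>msgs W M. h m g) \<le> F1.expectation (\<lambda>g. \<Sum>m\<in>msgs W M. h m g)"
    using F1.exists_le_expectation[of "\<lambda>g. \<Sum>m\<in>msgs W M. h m g" "\<lambda>g. \<forall>j\<in>Tx \<times> {..<n}. cmod (g j) \<le> b"] int
    by auto
  have "(\<Sum>m\<in>msgs W M. measure (noiseM Rx n) (gic_err Rx Wr Wb n (enc1 g) (dec1 g) m))
      \<le> (\<Sum>m\<in>msgs W M. h m g)"
    using measure_gic_err_le g by (intro sum_mono) (auto simp: h_def)
  also have "\<dots> \<le> (\<Sum>m\<in>msgs W M. F1.expectation (h m))"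
    using g(3) int by simp
  also have "\<dots> \<le> (\<Sum>m\<in>msgs W M. (real (card Rx) + 1) * measure (cb_space mu Rx Tx n) (err m))"
    by (intro sum_mono exp)
  finally have "gic_pe Rx W Wr Wb n M (enc1 g) (dec1 g)
      \<le> (real (card Rx) + 1) * cb_pe Tx Rx W Wr c mu L n M enc dec"
    by (simp add: gic_pe_def cb_pe_def sum_distrib_left[symmetric] divide_right_mono)
  moreover have "gic_code Rx W Wr Wb ((b * card Tx)\<^sup>2 * P) n M (enc1 g) (dec1 g)"
    unfolding gic_code_def using code enc1_power g gic_err_sets by (auto simp: cb_code_def)
  ultimately show ?thesis by blast
qed

end

section \<open>From codes to sum capacity and degrees of freedom\<close>

lemma gic_code_mono:
  "gic_code Rx W Wr Wb P n M enc dec \<Longrightarrow> P \<le> P' \<Longrightarrow> gic_code Rx W Wr Wb P' n M enc dec"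
  unfolding gic_code_def by (meson mult_left_mono of_nat_0_le_iff order_trans)

text \<open>Replacing \<open>P\<close> by \<open>K P\<close> changes \<open>log 2 P\<close> only by an additive constant.\<close>
lemma Limsup_div_log_scale_le:
  fixes f g :: "real \<Rightarrow> ereal"
  assumes K: "0 < K" and le: "\<And>P. 0 < P \<Longrightarrow> f P \<le> g (K * P)"
  shows "Limsup at_top (\<lambda>P. f P / ereal (log 2 P)) \<le> Limsup at_top (\<lambda>P. g P / ereal (log 2 P))"
\<comment> \<open>Testing against real upper bounds \<open>C\<close> of the right-hand side covers
  infinite limits as well.\<close>
proof (rule ereal_le_real)
  fix C assume C: "Limsup at_top (\<lambda>P. g P / ereal (log 2 P)) \<le> ereal C"
  show "Limsup at_top (\<lambda>P. f P / ereal (log 2 P)) \<le> ereal C"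
  proof (rule ereal_le_epsilon2)
    fix \<delta> :: real assume "0 < \<delta>"
    \<comment> \<open>One half of \<open>\<delta>\<close> makes the bound on \<open>g\<close>
      strict, the other absorbs \<open>D * log 2 K / log 2 P\<close>, which tends to 0.\<close>
    define D where "D = C + \<delta> / 2"
    have "Limsup at_top (\<lambda>P. g P / ereal (log 2 P)) < ereal D"
      using C \<open>0 < \<delta>\<close> by (auto simp: D_def intro: le_less_trans)
    then have "eventually (\<lambda>P. g P / ereal (log 2 P) < ereal D) at_top"
      by (rule Limsup_lessD)
    moreover have "filterlim (\<lambda>P. K * P) at_top at_top"
      using K by (intro filterlim_tendsto_pos_mult_at_top[OF tendsto_const]) (auto simp: filterlim_ident)
    ultimately have "eventually (\<lambda>P. g (K * P) / ereal (log 2 (K * P)) < ereal D) at_top"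
      by (rule eventually_compose_filterlim)
    moreover have "eventually (\<lambda>P. D * log 2 K / log 2 P < \<delta> / 2) at_top"
      using \<open>0 < \<delta>\<close> by real_asymp
    \<comment> \<open>These bounds make \<open>log 2 P\<close> and \<open>log 2 (K * P)\<close>
      positive, so that the quotients can be cleared.\<close>
    moreover have "eventually (\<lambda>P::real. 1 < P) at_top" "eventually (\<lambda>P. 1 / K < P) at_top"
      by (rule eventually_gt_at_top)+
    ultimately have "eventually (\<lambda>P. f P / ereal (log 2 P) \<le> ereal C + ereal \<delta>) at_top"
    proof eventually_elim
      case (elim P)
      have pos: "0 < log 2 P" "0 < log 2 (K * P)"
        using elim K by (auto simp: field_simps)
      have log: "log 2 (K * P) = log 2 K + log 2 P"
        using K elim by (simp add: log_mult)
      have "f P \<le> g (K * P)" using le elim by simp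
      also have "\<dots> \<le> ereal D * ereal (log 2 (K * P))"
        using elim(1) pos by (simp add: ereal_divide_less_iff less_imp_le mult.commute)
      finally have "f P / ereal (log 2 P) \<le> ereal (D * log 2 (K * P)) / ereal (log 2 P)"
        using pos by (intro ereal_divide_right_mono) auto
      also have "\<dots> = ereal (D + D * log 2 K / log 2 P)"
        using pos by (simp add: log field_simps)
      also have "\<dots> \<le> ereal (C + \<delta>)"
        using elim(2) unfolding D_def ereal_less_eq by linarith
      finally show ?case by simp
    qed
    then show "Limsup at_top (\<lambda>P. f P / ereal (log 2 P)) \<le> ereal C + ereal \<delta>"
      by (rule Limsup_bounded)
  qed
qed

theorem theorem8:
  fixes Tx :: "'t set" and Rx :: "'r set" and W :: "'m set"
    and Wt :: "'t \<Rightarrow> 'm set" and Wr :: "'r \<Rightarrow> 'm set"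
    and c :: "'r \<Rightarrow> 't \<Rightarrow> bool"
    and mu :: "complex measure" and L :: nat and a b :: real
  assumes "finite Tx" and "finite Rx" and "finite W"
    and "\<forall>t\<in>Tx. \<forall>t'\<in>Tx. t \<noteq> t' \<longrightarrow> Wt t \<inter> Wt t' = {}"
    and "(\<Union>t\<in>Tx. Wt t) = W"
    and "\<forall>r\<in>Rx. Wr r \<subseteq> W"
    and "0 < L"
    and "prob_space mu" and "sets mu = sets borel"
    and "absolutely_continuous lborel mu"
    and "0 < a" and "a \<le> b"
    and "AE z in mu. a \<le> cmod z \<and> cmod z \<le> b"
  shows "cb_dof Tx Rx W Wt Wr c mu L
           \<le> gic_dof Rx W Wr (\<lambda>r. \<Union>{Wt t | t. t \<in> Tx \<and> \<not> c r t})"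
proof -
  \<comment> \<open>The summand 1 keeps \<open>K\<close> positive even if \<open>Tx\<close> is
    empty.\<close>
  define K where "K = (b * card Tx)\<^sup>2 + 1"
  have "0 < K"
    by (simp add: K_def add_nonneg_pos)
  let ?Wb = "\<lambda>r. \<Union>{Wt t | t. t \<in> Tx \<and> \<not> c r t}"
  have bound: "AE z in mu. cmod z \<le> b"
    using assms(13) by eventually_elim simp
  have "gic_achievable Rx W Wr ?Wb (K * P) Rt"
    if "0 < P" and ach: "cb_achievable Tx Rx W Wt Wr c mu L P Rt" for P Rt
    unfolding gic_achievable_def
  proof (intro conjI allI impI)
    show "\<forall>w\<in>W. 0 \<le> Rt w" using ach by (simp add: cb_achievable_def)
    fix \<epsilon> :: real and N :: nat assume "0 < \<epsilon>"
    \<comment> \<open>The cellular code is taken at a smaller tolerance, so that the loss factor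
      \<open>card Rx + 1\<close> in the error brings it back to \<open>\<epsilon>\<close>; the
      message sizes \<open>M\<close>, and hence the rates, are kept.\<close>
    define \<delta> where "\<delta> = \<epsilon> / (real (card Rx) + 1)"
    have \<delta>: "0 < \<delta>" "\<delta> \<le> \<epsilon>" "(real (card Rx) + 1) * \<delta> = \<epsilon>"
      using \<open>0 < \<epsilon>\<close> by (auto simp: \<delta>_def field_simps)
    have "\<exists>n\<ge>N. \<exists>M enc dec. cb_code Tx Rx W Wt Wr c mu L P n M enc dec \<and>
        (\<forall>w\<in>W. real n * (Rt w - \<delta>) \<le> log 2 (real (M w))) \<and>
        cb_pe Tx Rx W Wr c mu L n M enc dec \<le> \<delta>"
      using ach \<delta>(1) unfolding cb_achievable_def by blast
    then obtain n M enc dec where n: "n \<ge> N"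
      and code: "cb_code Tx Rx W Wt Wr c mu L P n M enc dec"
      and rate: "\<And>w. w \<in> W \<Longrightarrow> real n * (Rt w - \<delta>) \<le> log 2 (real (M w))"
      and pe: "cb_pe Tx Rx W Wr c mu L n M enc dec \<le> \<delta>"
      by blast
    have "cellular_code Tx Rx W Wt Wr c mu L b P n M enc dec"
    proof (rule cellular_code.intro)
      show "Wt t \<subseteq> W" if "t \<in> Tx" for t using assms(5) that by blast
      show "Wr r \<subseteq> W" if "r \<in> Rx" for r using assms(6) that by blast
    qed (fact assms bound code)+
    from cellular_code.exists_gic_code[OF this]
    obtain enc' dec' where gic: "gic_code Rx W Wr ?Wb ((b * card Tx)\<^sup>2 * P) n M enc' dec'"
      and pe': "gic_pe Rx W Wr ?Wb n M enc' dec' \<le> (real (card Rx) + 1) * cb_pe Tx Rx W Wr c mu L n M enc dec"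
      by blast
    note pe'
    also have "(real (card Rx) + 1) * cb_pe Tx Rx W Wr c mu L n M enc dec \<le> (real (card Rx) + 1) * \<delta>"
      using pe by (intro mult_left_mono) auto
    finally have "gic_pe Rx W Wr ?Wb n M enc' dec' \<le> \<epsilon>" by (simp add: \<delta>(3))
    moreover have "gic_code Rx W Wr ?Wb (K * P) n M enc' dec'"
      using \<open>0 < P\<close> by (intro gic_code_mono[OF gic]) (simp add: K_def)
    moreover have "real n * (Rt w - \<epsilon>) \<le> log 2 (real (M w))" if "w \<in> W" for w
      using rate[OF that] \<delta>(2) by (smt (verit) mult_left_mono of_nat_0_le_iff)
    ultimately show "\<exists>n\<ge>N. \<exists>M enc dec. gic_code Rx W Wr ?Wb (K * P) n M enc dec \<and>
        (\<forall>w\<in>W. real n * (Rt w - \<epsilon>) \<le> log 2 (real (M w))) \<and> gic_pe Rx W Wr ?Wb n M enc dec \<le> \<epsilon>"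
      using n by blast
  qed
  then have "cb_sumcap Tx Rx W Wt Wr c mu L P \<le> gic_sumcap Rx W Wr ?Wb (K * P)" if "0 < P" for P
    unfolding cb_sumcap_def gic_sumcap_def using that by (intro SUP_subset_mono) auto
  with \<open>0 < K\<close> show ?thesis
    unfolding cb_dof_def gic_dof_def by (rule Limsup_div_log_scale_le)
qed

end
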